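(* Let $X$ be an ordered metric space, let $LX$ be the Lawvere metric space given by the set $X$ with the L-distance, and let $\ell:X\to LX$ be the map given by the identity on underlying sets. For every Lawvere metric space $\mathcal{Y}$ and every short, monotone map $f:X\to\mathcal{Y}$ (in the generalized sense), there exists a unique morphism of Lawvere metric spaces $\tilde f:LX\to\mathcal{Y}$ such that $\tilde f\circ\ell=f$.
   Context: An ordered metric space is a metric space $X$ with a partial order $\le$ whose graph $\{\le\}\subseteq X\times X$ is closed. The L-distance on an ordered metric space $X$ is $d_L(x,y)=\sup_f\,(f(x)-f(y))$, the supremum over all short (1-Lipschitz) monotone maps $f:X\to\mathbb{R}$. A Lawvere metric space (here with finite values) is a set $\mathcal{X}$ with a function $d_L:\mathcal{X}\times\mathcal{X}\to[0,\infty)$ such that $d_L(x,x)=0$ and $d_L(x,z)\le d_L(x,y)+d_L(y,z)$ for all $x,y,z$. A morphism of Lawvere metric spaces is a function $f$ with $d_L(f(x),f(x'))\le d_L(x,x')$ for all $x,x'$. A function $f:X\to\mathcal{Y}$ from an ordered metric space to a Lawvere metric space is called short if $d_L(f(x),f(x'))\le d(x,x')$ for all $x,x'\in X$, and monotone if $x\le x'$ implies $d_L(f(x),f(x'))=0$. *)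

theory Defs
  imports "HOL-Analysis.Analysis"
begin

locale ordered_metric_space = Metric_space M d
  for M :: "'a set" and d :: "'a \<Rightarrow> 'a \<Rightarrow> real" +
  fixes r :: "('a \<times> 'a) set"
  assumes partial_order: "partial_order_on M r"
    and closed_graph: "closedin (prod_topology mtopology mtopology) r"
begin

definition short_monotone_real :: "('a \<Rightarrow> real) \<Rightarrow> bool" where
  "short_monotone_real f \<longleftrightarrow>
     (\<forall>x\<in>M. \<forall>y\<in>M. \<bar>f x - f y\<bar> \<le> d x y) \<and>
     (\<forall>x\<in>M. \<forall>y\<in>M. (x, y) \<in> r \<longrightarrow> f x \<le> f y)"

text \<open>The supremum is taken in \<open>real\<close>; for points of \<open>M\<close> the set is nonempty and
  bounded above by \<open>d x y\<close> (lemmas \<open>ex_short_monotone_real\<close> and \<open>bdd_above_L_dist\<close>).\<close>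

definition L_dist :: "'a \<Rightarrow> 'a \<Rightarrow> real" where
  "L_dist x y = (SUP f\<in>{f. short_monotone_real f}. f x - f y)"

definition L_map :: "'a \<Rightarrow> 'a" where
  "L_map = (\<lambda>x\<in>M. x)"

end

locale Lawvere_metric_space =
  fixes Y :: "'b set" and e :: "'b \<Rightarrow> 'b \<Rightarrow> real"
  assumes nonneg: "\<lbrakk>x \<in> Y; y \<in> Y\<rbrakk> \<Longrightarrow> 0 \<le> e x y"
    and refl: "x \<in> Y \<Longrightarrow> e x x = 0"
    and triangle: "\<lbrakk>x \<in> Y; y \<in> Y; z \<in> Y\<rbrakk> \<Longrightarrow> e x z \<le> e x y + e y z"

text \<open>Maps between carrier sets are extensional functions, so that equality of maps is
  equality in HOL and composition is \<^const>\<open>compose\<close>.\<close>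

locale Lawvere_morphism =
  dom: Lawvere_metric_space A a + cod: Lawvere_metric_space B b
  for A :: "'a set" and a and B :: "'b set" and b +
  fixes g :: "'a \<Rightarrow> 'b"
  assumes map: "g \<in> A \<rightarrow>\<^sub>E B"
    and dist_le: "\<lbrakk>x \<in> A; y \<in> A\<rbrakk> \<Longrightarrow> b (g x) (g y) \<le> a x y"

locale short_monotone_map =
  dom: ordered_metric_space M d r + cod: Lawvere_metric_space Y e
  for M :: "'a set" and d and r and Y :: "'b set" and e +
  fixes f :: "'a \<Rightarrow> 'b"
  assumes map: "f \<in> M \<rightarrow>\<^sub>E Y"
    and short: "\<lbrakk>x \<in> M; y \<in> M\<rbrakk> \<Longrightarrow> e (f x) (f y) \<le> d x y"
    and monotone: "\<lbrakk>x \<in> M; y \<in> M; (x, y) \<in> r\<rbrakk> \<Longrightarrow> e (f x) (f y) = 0"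

context ordered_metric_space
begin

lemma ex_short_monotone_real: "{f. short_monotone_real f} \<noteq> {}"
proof -
  have "short_monotone_real (\<lambda>_. 0)"
    by (simp add: short_monotone_real_def)
  then show ?thesis by blast
qed

lemma bdd_above_L_dist:
  assumes "x \<in> M" "y \<in> M"
  shows "bdd_above ((\<lambda>f. f x - f y) ` {f. short_monotone_real f})"
  using assms unfolding short_monotone_real_def
  by (intro bdd_aboveI[where M = "d x y"]) (fastforce simp: abs_le_iff)

lemma L_dist_ge:
  assumes "x \<in> M" "y \<in> M" "short_monotone_real f"
  shows "f x - f y \<le> L_dist x y"
  unfolding L_dist_def using assms by (intro cSUP_upper bdd_above_L_dist) auto

lemma Lawvere_metric_space_L_dist: "Lawvere_metric_space M L_dist"
proof
  fix x y assume "x \<in> M" "y \<in> M"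
  then show "0 \<le> L_dist x y"
    using L_dist_ge[of x y "\<lambda>_. 0"] by (simp add: short_monotone_real_def)
next
  fix x
  show "L_dist x x = 0"
    using ex_short_monotone_real by (simp add: L_dist_def)
next
  fix x y z assume M: "x \<in> M" "y \<in> M" "z \<in> M"
  show "L_dist x z \<le> L_dist x y + L_dist y z"
    unfolding L_dist_def[of x z]
  proof (rule cSUP_least[OF ex_short_monotone_real])
    fix f assume "f \<in> {f. short_monotone_real f}"
    then show "f x - f z \<le> L_dist x y + L_dist y z"
      using L_dist_ge[of x y f] L_dist_ge[of y z f] M by simp
  qed
qed

end

end

theory Submission
  imports Defs
begin

text \<open>The functions \<open>x \<mapsto> e (f x) (f y)\<close> are short and monotone, and they vanish at \<open>y\<close>, so the
  supremum defining the L-distance dominates \<open>e (f x) (f y)\<close>.\<close>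

context short_monotone_map
begin

lemma short_monotone_real_dist:
  assumes y: "y \<in> M"
  shows "dom.short_monotone_real (\<lambda>x. e (f x) (f y))"
proof -
  have f_in: "f x \<in> Y" if "x \<in> M" for x
    using map that by (rule PiE_mem)
  have diff_le: "e (f x) (f y) - e (f x') (f y) \<le> e (f x) (f x')" if "x \<in> M" "x' \<in> M" for x x'
    using cod.triangle[of "f x" "f x'" "f y"] f_in that y by simp
  \<comment> \<open>Since \<open>e\<close> may be asymmetric, the two signs of the difference are
    bounded by \<open>e (f x) (f x')\<close> and \<open>e (f x') (f x)\<close> respectively;
    symmetry of \<open>d\<close> turns both into \<open>d x x'\<close>.\<close>
  have "\<bar>e (f x) (f y) - e (f x') (f y)\<bar> \<le> d x x'" if "x \<in> M" "x' \<in> M" for x x'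
    using diff_le[of x x'] diff_le[of x' x] short[of x x'] short[of x' x] dom.commute[of x x'] that
    by linarith
  \<comment> \<open>Here the bound in \<open>diff_le\<close> is 0 by
    \<open>monotone\<close>.\<close>
  moreover have "e (f x) (f y) \<le> e (f x') (f y)" if "x \<in> M" "x' \<in> M" "(x, x') \<in> r" for x x'
    using diff_le[of x x'] monotone[of x x'] that by simp
  ultimately show ?thesis
    by (simp add: dom.short_monotone_real_def)
qed

lemma dist_le_L_dist:
  assumes "x \<in> M" "y \<in> M"
  shows "e (f x) (f y) \<le> dom.L_dist x y"
  using dom.L_dist_ge[OF assms short_monotone_real_dist[OF assms(2)]] cod.refl[of "f y"]
    PiE_mem[OF map assms(2)]
  by simp

text \<open>Existence: \<open>LX\<close> has the same points as \<open>X\<close>, so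
  \<open>f\<close> itself serves as the lift.\<close>

lemma Lawvere_morphism_L_dist: "Lawvere_morphism M dom.L_dist Y e f"
  by (simp add: Lawvere_morphism_def Lawvere_morphism_axioms_def map dist_le_L_dist
      dom.Lawvere_metric_space_L_dist cod.Lawvere_metric_space_axioms)

end

text \<open>\<open>L_map\<close> is the identity restricted to \<open>M\<close>, so the composite is
  \<open>g\<close> restricted to \<open>M\<close>, which extensionality makes \<open>g\<close>
  itself.\<close>

lemma (in ordered_metric_space) compose_L_map:
  assumes "g \<in> extensional M"
  shows "compose M g L_map = g"
  using assms by (auto simp: compose_def L_map_def extensional_def)

theorem mainTheorem14:
  fixes X :: "'a set" and d :: "'a \<Rightarrow> 'a \<Rightarrow> real" and r :: "('a \<times> 'a) set"
    and Y :: "'b set" and e :: "'b \<Rightarrow> 'b \<Rightarrow> real" and f :: "'a \<Rightarrow> 'b"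
  assumes "ordered_metric_space X d r"
    and "Lawvere_metric_space Y e"
    and "short_monotone_map X d r Y e f"
  shows "\<exists>!g. Lawvere_morphism X (ordered_metric_space.L_dist X d r) Y e g
            \<and> compose X g (ordered_metric_space.L_map X) = f"
proof -
  interpret short_monotone_map X d r Y e f by fact
  have compose_eq: "compose X g dom.L_map = g" if "g \<in> X \<rightarrow>\<^sub>E Y" for g :: "'a \<Rightarrow> 'b"
    using that by (simp add: PiE_def dom.compose_L_map)
  show ?thesis
  proof (intro ex1I conjI)
    show "Lawvere_morphism X dom.L_dist Y e f"
      by (rule Lawvere_morphism_L_dist)
    show "compose X f dom.L_map = f"
      by (rule compose_eq[OF map])
  next
    fix g
    assume "Lawvere_morphism X dom.L_dist Y e g \<and> compose X g dom.L_map = f"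
    \<comment> \<open>Uniqueness is set-theoretic: as a morphism \<open>g\<close> is extensional on
      \<open>X\<close>, so its composite with \<open>L_map\<close> is both \<open>g\<close> and
      \<open>f\<close>.\<close>
    then show "g = f"
      using compose_eq[OF Lawvere_morphism.map] by metis
  qed
qed

end
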